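(* Let $ABC$ be a (non-degenerate) triangle and let $\alpha,\beta,\gamma\in(0,\pi)$ with $\alpha+\beta+\gamma=\pi$. There exists a triangle $M_1N_1P_1\in\mathcal{I}_{\alpha\beta\gamma}$ which has the smallest area amongst all triangles in the class $\mathcal{I}_{\alpha\beta\gamma}$. Also, there exists a triangle $M_2N_2P_2\in\mathcal{C}_{\alpha\beta\gamma}$ which has the largest area amongst all triangles in the class $\mathcal{C}_{\alpha\beta\gamma}$. In addition, any two such triangles satisfy $$|\Delta M_1N_1P_1|\cdot|\Delta M_2N_2P_2|=|\Delta ABC|^2.$$ Moreover, the same results (existence of an area-minimizer $M_1N_1P_1$ in the inscribed class, existence of an area-maximizer $M_2N_2P_2$ in the corresponding circumscribed class, and the identity $|\Delta M_1N_1P_1|\cdot|\Delta M_2N_2P_2|=|\Delta ABC|^2$ for any two such extremal triangles) hold with the pair $(\mathcal{I}_{\alpha\beta\gamma},\mathcal{C}_{\alpha\beta\gamma})$ replaced by $(\mathcal{I}_{\theta_1\theta_2\theta_3},\mathcal{C}_{\theta_1\theta_2\theta_3})$ for any permutation $(\theta_1,\theta_2,\theta_3)$ of $(\alpha,\beta,\gamma)$, and with it replaced by the pair $(\mathcal{I},\mathcal{C})$.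
   Context: $|\Delta XYZ|$ denotes the area of triangle $XYZ$. Fix the triangle $ABC$ (the reference triangle). For an ordered triple of angles $(\theta_1,\theta_2,\theta_3)$ in $(0,\pi)$ with sum $\pi$: $\mathcal{I}_{\theta_1\theta_2\theta_3}$ is the set of all triangles $XYZ$ with $X,Y,Z$ belonging, respectively, to the lines $BC$, $AC$, $AB$, and whose (unoriented) angles at $X,Y,Z$ are $\theta_1,\theta_2,\theta_3$, in this order. $\mathcal{C}_{\theta_1\theta_2\theta_3}$ is the set of all triangles $XYZ$ such that $A,B,C$ belong, respectively, to the lines $YZ$, $XZ$, $XY$, and whose (unoriented) angles at $X,Y,Z$ are $\theta_1,\theta_2,\theta_3$, in this order. $\mathcal{I}$ (the triangles inscribed in $ABC$ and similar to a fundamental triangle with angles $\alpha,\beta,\gamma$) is the union of the six classes $\mathcal{I}_{\theta_1\theta_2\theta_3}$ over all permutations $(\theta_1,\theta_2,\theta_3)$ of $(\alpha,\beta,\gamma)$; $\mathcal{C}$ (the triangles circumscribed to $ABC$ and similar to the fundamental triangle) is the union of the six classes $\mathcal{C}_{\theta_1\theta_2\theta_3}$ over the same permutations. *)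

theory Defs
  imports "HOL-Analysis.Analysis" "HOL-Library.Multiset"
begin

type_synonym point = "real^2"
type_synonym triangle = "point \<times> point \<times> point"

text \<open>The unoriented angle at the first argument, meaningful when it differs from the other two.\<close>

definition angle_at :: "point \<Rightarrow> point \<Rightarrow> point \<Rightarrow> real" where
  "angle_at X Y Z = arccos (((Y - X) \<bullet> (Z - X)) / (norm (Y - X) * norm (Z - X)))"

definition has_angles :: "point \<Rightarrow> point \<Rightarrow> point \<Rightarrow> real \<Rightarrow> real \<Rightarrow> real \<Rightarrow> bool" where
  "has_angles X Y Z \<theta>1 \<theta>2 \<theta>3 \<longleftrightarrow>
     angle_at X Y Z = \<theta>1 \<and> angle_at Y Z X = \<theta>2 \<and> angle_at Z X Y = \<theta>3"

fun area :: "triangle \<Rightarrow> real" where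
  "area (X, Y, Z) = measure lebesgue (convex hull {X, Y, Z})"

text \<open>Lines are rendered as affine hulls. Members of the classes are non-degenerate triangles, listed
  by their vertices in the order that matches the angles; both orientations occur.\<close>

definition inscribed_class ::
  "point \<Rightarrow> point \<Rightarrow> point \<Rightarrow> real \<Rightarrow> real \<Rightarrow> real \<Rightarrow> triangle set" where
  "inscribed_class A B C \<theta>1 \<theta>2 \<theta>3 =
     {(X, Y, Z). \<not> collinear {X, Y, Z} \<and>
        X \<in> affine hull {B, C} \<and> Y \<in> affine hull {A, C} \<and> Z \<in> affine hull {A, B} \<and>
        has_angles X Y Z \<theta>1 \<theta>2 \<theta>3}"

definition circumscribed_class ::
  "point \<Rightarrow> point \<Rightarrow> point \<Rightarrow> real \<Rightarrow> real \<Rightarrow> real \<Rightarrow> triangle set" where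
  "circumscribed_class A B C \<theta>1 \<theta>2 \<theta>3 =
     {(X, Y, Z). \<not> collinear {X, Y, Z} \<and>
        A \<in> affine hull {Y, Z} \<and> B \<in> affine hull {X, Z} \<and> C \<in> affine hull {X, Y} \<and>
        has_angles X Y Z \<theta>1 \<theta>2 \<theta>3}"

definition angle_perms :: "real \<Rightarrow> real \<Rightarrow> real \<Rightarrow> (real \<times> real \<times> real) set" where
  "angle_perms \<alpha> \<beta> \<gamma> = {(\<theta>1, \<theta>2, \<theta>3). mset [\<theta>1, \<theta>2, \<theta>3] = mset [\<alpha>, \<beta>, \<gamma>]}"

definition inscribed_similar ::
  "point \<Rightarrow> point \<Rightarrow> point \<Rightarrow> real \<Rightarrow> real \<Rightarrow> real \<Rightarrow> triangle set" where
  "inscribed_similar A B C \<alpha> \<beta> \<gamma> =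
     (\<Union>(\<theta>1, \<theta>2, \<theta>3) \<in> angle_perms \<alpha> \<beta> \<gamma>. inscribed_class A B C \<theta>1 \<theta>2 \<theta>3)"

definition circumscribed_similar ::
  "point \<Rightarrow> point \<Rightarrow> point \<Rightarrow> real \<Rightarrow> real \<Rightarrow> real \<Rightarrow> triangle set" where
  "circumscribed_similar A B C \<alpha> \<beta> \<gamma> =
     (\<Union>(\<theta>1, \<theta>2, \<theta>3) \<in> angle_perms \<alpha> \<beta> \<gamma>. circumscribed_class A B C \<theta>1 \<theta>2 \<theta>3)"

definition smallest_area_in :: "triangle \<Rightarrow> triangle set \<Rightarrow> bool" where
  "smallest_area_in T S \<longleftrightarrow> T \<in> S \<and> (\<forall>T'\<in>S. area T \<le> area T')"

definition largest_area_in :: "triangle \<Rightarrow> triangle set \<Rightarrow> bool" where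
  "largest_area_in T S \<longleftrightarrow> T \<in> S \<and> (\<forall>T'\<in>S. area T' \<le> area T)"

definition extremal_area_duality :: "triangle \<Rightarrow> triangle set \<Rightarrow> triangle set \<Rightarrow> bool" where
  "extremal_area_duality T0 I C \<longleftrightarrow>
     (\<exists>T1. smallest_area_in T1 I) \<and>
     (\<exists>T2. largest_area_in T2 C) \<and>
     (\<forall>T1 T2. smallest_area_in T1 I \<longrightarrow> largest_area_in T2 C \<longrightarrow> area T1 * area T2 = (area T0)\<^sup>2)"

end

theory Submission
  imports Defs
begin

text \<open>
  For triangles \<open>ABC\<close> and \<open>XYZ\<close> put
  \<open>E = A \<times> (Z - Y) + B \<times> (X - Z) + C \<times> (Y - X)\<close>, with \<open>\<times>\<close> the planar cross product. This
  expression is bilinear and symmetric in the two triangles, invariant under translation of either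
  one, and equal to the double signed area of the outer triangle whenever one of them is inscribed in
  the other (\<open>mixed_if_circumscribes\<close>). Conversely, a homothetic copy of one triangle whose ratio is
  chosen so that \<open>E\<close> takes this value can be translated into inscribed or circumscribed position
  (\<open>homothetic_copy_inscribed\<close>, \<open>homothetic_copy_circumscribed\<close>), because the three incidence
  conditions are linear in the translation vector and \<open>E\<close> is their only obstruction.

  Hence every triangle \<open>XYZ\<close> inscribed in \<open>ABC\<close> has a homothetic copy circumscribed to \<open>ABC\<close>, and vice
  versa; in both directions the ratio is the quotient of the signed areas of \<open>ABC\<close> and \<open>XYZ\<close>, so the
  areas of the two copies have product \<open>|ABC|\<^sup>2\<close> (\<open>inscribed_has_dual\<close>,
  \<open>circumscribed_has_dual\<close>). A homothety preserves angles, so this pairs the inscribed with the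
  circumscribed class of the same angles, and likewise their unions. Since the areas of paired
  triangles are reciprocal up to the constant \<open>|ABC|\<^sup>2\<close>, everything follows from the existence
  of a largest circumscribed triangle (\<open>extremal_area_duality_if_dual\<close>).

  A triangle \<open>XYZ\<close> with the prescribed angles is determined by \<open>X\<close>, the vector \<open>u = Y - X\<close> and an
  orientation \<open>\<sigma> = \<plusminus>1\<close>: there are constants \<open>p\<close> and \<open>q > 0\<close> with \<open>Z - X = p u + \<sigma> q u'\<close>, where
  \<open>u'\<close> is \<open>u\<close> turned by a right angle. For fixed \<open>\<sigma>\<close> the number \<open>E\<close> is then linear in \<open>u\<close>, say
  \<open>E = g \<sigma> \<bullet> u\<close>, and the triangle can be circumscribed only if \<open>g \<sigma> \<bullet> u = \<sigma> q |u|\<^sup>2\<close>. By the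
  Cauchy-Schwarz inequality this bounds \<open>|u|\<close> by \<open>|g \<sigma>| / q\<close>, with equality for
  \<open>u = (\<sigma> / q) g \<sigma>\<close>. The orientation with the longer vector \<open>g \<sigma>\<close> gives the maximum; that vector is
  nonzero because \<open>g 1 - g (-1) = 2 q (A - B)\<close>.
\<close>

section \<open>Cross product, signed area, lines\<close>

text \<open>The planar cross product: the determinant with columns \<open>x\<close> and \<open>y\<close>.\<close>

definition cross2 :: "point \<Rightarrow> point \<Rightarrow> real" where
  "cross2 x y = x$1 * y$2 - x$2 * y$1"

text \<open>Counterclockwise rotation by a right angle.\<close>

definition turn :: "point \<Rightarrow> point" where
  "turn x = vector [- x$2, x$1]"

text \<open>Twice the signed area of \<open>XYZ\<close>, positive for counterclockwise order.\<close>

definition darea :: "point \<Rightarrow> point \<Rightarrow> point \<Rightarrow> real" where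
  "darea X Y Z = cross2 (Y - X) (Z - X)"

text \<open>The bilinear form \<open>E\<close> of the introduction: each vertex of the first triangle is paired with the edge
  opposite to the vertex of the second triangle with the same position.\<close>

definition mixed :: "triangle \<Rightarrow> triangle \<Rightarrow> real" where
  "mixed = (\<lambda>(A, B, C) (X, Y, Z). cross2 A (Z - Y) + cross2 B (X - Z) + cross2 C (Y - X))"

lemma turn_nth [simp]: "turn x $ 1 = - x$2" "turn x $ 2 = x$1"
  by (simp_all add: turn_def)

lemma inner_coords: "x \<bullet> y = x$1 * y$1 + x$2 * y$2" for x y :: point
  by (simp add: inner_vec_def sum_2)

lemma norm_square_coords: "(norm x)\<^sup>2 = (x$1)\<^sup>2 + (x$2)\<^sup>2" for x :: point
  unfolding power2_norm_eq_inner by (simp add: inner_coords power2_eq_square)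

text \<open>With \<open>x \<bullet> y = |x| |y| cos \<theta>\<close> and \<open>0 \<le> \<theta> \<le> \<pi>\<close> this gives \<open>|x \<times> y| = |x| |y| sin \<theta>\<close>.\<close>

lemma lagrange_identity_2: "(cross2 x y)\<^sup>2 + (x \<bullet> y)\<^sup>2 = (norm x)\<^sup>2 * (norm y)\<^sup>2"
  unfolding norm_square_coords inner_coords cross2_def by algebra

text \<open>The coordinates of \<open>w\<close> in the orthogonal basis of \<open>u\<close> and \<open>turn u\<close>, with the common denominator
  cleared so that \<open>u = 0\<close> needs no exception.\<close>

lemma decompose_along:
  fixes u w :: point
  shows "(norm u)\<^sup>2 *\<^sub>R w = (u \<bullet> w) *\<^sub>R u + cross2 u w *\<^sub>R turn u"
  unfolding norm_square_coords inner_coords cross2_def vec_eq_iff forall_2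
  by (simp add: algebra_simps power2_eq_square)

lemma on_line_iff:
  fixes P Q R :: point
  assumes "P \<noteq> Q"
  shows "R \<in> affine hull {P, Q} \<longleftrightarrow> cross2 (R - P) (Q - P) = 0"
proof
  assume "R \<in> affine hull {P, Q}"
  then obtain s t where "R = s *\<^sub>R P + t *\<^sub>R Q" "s + t = 1"
    by (auto simp: affine_hull_2)
  moreover from this have "s = 1 - t" by simp
  ultimately have "R - P = t *\<^sub>R (Q - P)"
    by (simp add: scaleR_left_diff_distrib scaleR_right_diff_distrib)
  then show "cross2 (R - P) (Q - P) = 0"
    by (simp add: cross2_def)
next
  assume 0: "cross2 (R - P) (Q - P) = 0"
  define t where "t = ((Q - P) \<bullet> (R - P)) / (norm (Q - P))\<^sup>2"
  have nz: "(norm (Q - P))\<^sup>2 \<noteq> 0" using assms by simp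
  have "cross2 (Q - P) (R - P) = 0" using 0 by (simp add: cross2_def algebra_simps)
  then have "(norm (Q - P))\<^sup>2 *\<^sub>R (R - P) = ((Q - P) \<bullet> (R - P)) *\<^sub>R (Q - P)"
    using decompose_along[of "Q - P" "R - P"] by simp
  then have "(norm (Q - P))\<^sup>2 *\<^sub>R (R - P) = (norm (Q - P))\<^sup>2 *\<^sub>R (t *\<^sub>R (Q - P))"
    using nz by (simp add: t_def)
  then have "R - P = t *\<^sub>R (Q - P)"
    using nz by (rule scaleR_left_imp_eq[rotated])
  then have "R = (1 - t) *\<^sub>R P + t *\<^sub>R Q"
    by (simp add: algebra_simps)
  then show "R \<in> affine hull {P, Q}"
    unfolding affine_hull_2 mem_Collect_eq by (intro exI[of _ "1 - t"] exI[of _ t]) simp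
qed

lemma collinear_iff_darea: "collinear {X, Y, Z} \<longleftrightarrow> darea X Y Z = 0"
proof (cases "X = Y")
  case True
  then show ?thesis by (simp add: darea_def cross2_def)
next
  case False
  then have "collinear {X, Y, Z} \<longleftrightarrow> Z \<in> affine hull {X, Y}"
    by (rule collinear_3_affine_hull)
  also have "\<dots> \<longleftrightarrow> darea X Y Z = 0"
    unfolding on_line_iff[OF False] by (auto simp: darea_def cross2_def algebra_simps)
  finally show ?thesis .
qed

lemma area_eq_darea: "area (X, Y, Z) = \<bar>darea X Y Z\<bar> / 2"
proof -
  have "compact (convex hull {X, Y, Z})"
    by (intro finite_imp_compact_convex_hull) auto
  then have "convex hull {X, Y, Z} \<in> sets borel"
    by (rule borel_compact)
  then have "area (X, Y, Z) = measure lborel (convex hull {X, Y, Z})"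
    by (simp add: measure_completion)
  then show ?thesis
    by (simp add: content_triangle darea_def cross2_def abs_minus_commute mult.commute)
qed

text \<open>From here on areas are computed from \<open>darea\<close>, not unfolded to Lebesgue measure.\<close>

declare area.simps [simp del]

lemma area_pos_iff: "0 < area (X, Y, Z) \<longleftrightarrow> \<not> collinear {X, Y, Z}"
  by (simp add: area_eq_darea collinear_iff_darea)

text \<open>Cramer's rule: the cross products of a vector with two independent vectors can be prescribed.\<close>

lemma cross2_system_solvable:
  assumes "cross2 e f \<noteq> 0"
  obtains v where "cross2 v e = s" "cross2 v f = t"
proof
  let ?v = "(t / cross2 e f) *\<^sub>R e - (s / cross2 e f) *\<^sub>R f"
  have *: "cross2 (a *\<^sub>R e - b *\<^sub>R f) e = b * cross2 e f"
    "cross2 (a *\<^sub>R e - b *\<^sub>R f) f = a * cross2 e f" for a b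
    by (simp_all add: cross2_def algebra_simps)
  show "cross2 ?v e = s" "cross2 ?v f = t"
    using assms by (simp_all add: *)
qed

section \<open>Inscribed and circumscribed triangles\<close>

text \<open>For \<open>k \<noteq> 0\<close> the homothety of ratio \<open>k\<close>, which may be negative, that sends the origin to \<open>v\<close>; the
  translation by \<open>v\<close> if \<open>k = 1\<close>.\<close>

definition homothetic :: "point \<Rightarrow> real \<Rightarrow> point \<Rightarrow> point" where
  "homothetic v k X = v + k *\<^sub>R X"

lemma darea_homothetic:
  "darea (homothetic v k X) (homothetic v k Y) (homothetic v k Z) = k\<^sup>2 * darea X Y Z"
  by (simp add: darea_def cross2_def homothetic_def algebra_simps power2_eq_square)

lemma angle_at_homothetic:
  assumes "k \<noteq> 0"
  shows "angle_at (homothetic v k X) (homothetic v k Y) (homothetic v k Z) = angle_at X Y Z"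
proof -
  have diff: "homothetic v k P - homothetic v k Q = k *\<^sub>R (P - Q)" for P Q
    by (simp add: homothetic_def algebra_simps)
  have "(k * (k * c)) / (\<bar>k\<bar> * n * (\<bar>k\<bar> * m)) = c / (n * m)" for c n m :: real
    using assms by (cases "k > 0") (auto simp: field_simps abs_if)
  then show ?thesis
    unfolding angle_at_def diff by simp
qed

text \<open>The points \<open>A\<close>, \<open>B\<close>, \<open>C\<close> lie on the side lines of \<open>XYZ\<close> opposite to \<open>X\<close>, \<open>Y\<close>, \<open>Z\<close>. Stated by vanishing
  cross products, so that it is polynomial in the coordinates; it agrees with the incidences in terms
  of affine hulls when \<open>XYZ\<close> is non-degenerate.\<close>

definition circumscribes :: "triangle \<Rightarrow> triangle \<Rightarrow> bool" where
  "circumscribes = (\<lambda>(X, Y, Z) (A, B, C). cross2 (A - Y) (Z - Y) = 0 \<and>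
     cross2 (B - Z) (X - Z) = 0 \<and> cross2 (C - X) (Y - X) = 0)"

lemma distinct_if_not_collinear:
  fixes X Y Z :: point
  assumes "\<not> collinear {X, Y, Z}"
  shows "X \<noteq> Y" "Y \<noteq> Z" "X \<noteq> Z"
  using assms by (auto simp: collinear_iff_darea darea_def cross2_def)

lemma circumscribes_iff:
  assumes "\<not> collinear {X, Y, Z}"
  shows "circumscribes (X, Y, Z) (A, B, C) \<longleftrightarrow>
    A \<in> affine hull {Y, Z} \<and> B \<in> affine hull {X, Z} \<and> C \<in> affine hull {X, Y}"
  using distinct_if_not_collinear[OF assms]
  by (simp add: circumscribes_def on_line_iff insert_commute[of X Z])

lemma inscribed_class_iff:
  assumes "\<not> collinear {A, B, C}"
  shows "(X, Y, Z) \<in> inscribed_class A B C \<theta>1 \<theta>2 \<theta>3 \<longleftrightarrow>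
    \<not> collinear {X, Y, Z} \<and> circumscribes (A, B, C) (X, Y, Z) \<and> has_angles X Y Z \<theta>1 \<theta>2 \<theta>3"
  by (auto simp: inscribed_class_def circumscribes_iff[OF assms])

lemma circumscribed_class_iff:
  "(X, Y, Z) \<in> circumscribed_class A B C \<theta>1 \<theta>2 \<theta>3 \<longleftrightarrow>
    \<not> collinear {X, Y, Z} \<and> circumscribes (X, Y, Z) (A, B, C) \<and> has_angles X Y Z \<theta>1 \<theta>2 \<theta>3"
  by (auto simp: circumscribed_class_def circumscribes_iff)

lemma mixed_commute: "mixed (A, B, C) (X, Y, Z) = mixed (X, Y, Z) (A, B, C)"
  by (simp add: mixed_def cross2_def algebra_simps)

text \<open>The incidences allow each of \<open>A\<close>, \<open>B\<close>, \<open>C\<close> to be replaced, inside its cross product, by a vertex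
  of \<open>XYZ\<close> on the same line.\<close>

lemma mixed_if_circumscribes:
  assumes "circumscribes (X, Y, Z) (A, B, C)"
  shows "mixed (A, B, C) (X, Y, Z) = darea X Y Z"
  using assms unfolding circumscribes_def mixed_def darea_def cross2_def
  by (simp add: algebra_simps)

lemma circumscribes_homothetic:
  assumes "circumscribes (X, Y, Z) (A, B, C)"
  shows "circumscribes (homothetic v k X, homothetic v k Y, homothetic v k Z)
    (homothetic v k A, homothetic v k B, homothetic v k C)"
proof -
  have "cross2 (homothetic v k P - homothetic v k Q) (homothetic v k R - homothetic v k Q) =
      k\<^sup>2 * cross2 (P - Q) (R - Q)" for P Q R
    by (simp add: homothetic_def cross2_def algebra_simps power2_eq_square)
  then show ?thesis
    using assms by (simp add: circumscribes_def)
qed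

text \<open>Two of the three incidences fix the translation \<open>v\<close>. The edge vectors of \<open>ABC\<close> sum to zero, so the
  condition on \<open>k\<close> says exactly that the third incidence follows.\<close>

lemma homothetic_copy_inscribed:
  assumes "darea A B C \<noteq> 0" "k * mixed (A, B, C) (X, Y, Z) = darea A B C"
  obtains v where "circumscribes (A, B, C)
    (homothetic v k X, homothetic v k Y, homothetic v k Z)"
proof -
  have "cross2 (A - C) (B - A) \<noteq> 0"
    using assms(1) by (simp add: darea_def cross2_def algebra_simps)
  then obtain v where
    "cross2 v (A - C) = cross2 (C - k *\<^sub>R Y) (A - C)"
    "cross2 v (B - A) = cross2 (A - k *\<^sub>R Z) (B - A)"
    by (rule cross2_system_solvable)
  then have "circumscribes (A, B, C) (homothetic v k X, homothetic v k Y, homothetic v k Z)"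
    using assms(2)
    by (simp add: circumscribes_def mixed_def darea_def homothetic_def cross2_def algebra_simps)
  then show ?thesis by (rule that)
qed

text \<open>A copy of \<open>XYZ\<close> with ratio \<open>k\<close> around \<open>ABC\<close> amounts to a copy of \<open>ABC\<close> with ratio \<open>1/k\<close> inside \<open>XYZ\<close>.\<close>

lemma homothetic_copy_circumscribed:
  assumes "darea X Y Z \<noteq> 0" "mixed (A, B, C) (X, Y, Z) = k * darea X Y Z" "k \<noteq> 0"
  obtains v where "circumscribes
    (homothetic v k X, homothetic v k Y, homothetic v k Z) (A, B, C)"
proof -
  have "(1 / k) * mixed (X, Y, Z) (A, B, C) = darea X Y Z"
    using assms by (simp add: mixed_commute[of X])
  with assms(1) obtain w where "circumscribes (X, Y, Z)
      (homothetic w (1 / k) A, homothetic w (1 / k) B, homothetic w (1 / k) C)"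
    by (rule homothetic_copy_inscribed)
  \<comment> \<open>This homothety is the inverse of the one with translation \<open>w\<close> and ratio \<open>1/k\<close>.\<close>
  from circumscribes_homothetic[OF this, of "- k *\<^sub>R w" k]
  have "circumscribes (homothetic (- k *\<^sub>R w) k X, homothetic (- k *\<^sub>R w) k Y,
      homothetic (- k *\<^sub>R w) k Z) (A, B, C)"
    using assms(3) by (simp add: homothetic_def algebra_simps)
  then show ?thesis by (rule that)
qed

lemma has_angles_homothetic:
  assumes "k \<noteq> 0"
  shows "has_angles (homothetic v k X) (homothetic v k Y) (homothetic v k Z) \<theta>1 \<theta>2 \<theta>3
    \<longleftrightarrow> has_angles X Y Z \<theta>1 \<theta>2 \<theta>3"
  by (simp add: has_angles_def angle_at_homothetic[OF assms])

text \<open>The area computation behind the duality: a homothety of ratio \<open>t / s\<close> multiplies the double signed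
  area \<open>s\<close> by \<open>(t / s)\<^sup>2\<close>.\<close>

lemma half_abs_mult_half_abs:
  fixes s t :: real
  assumes "s \<noteq> 0"
  shows "\<bar>s\<bar> / 2 * (\<bar>(t / s)\<^sup>2 * s\<bar> / 2) = (\<bar>t\<bar> / 2)\<^sup>2"
  using assms by (simp add: abs_mult power2_eq_square field_simps)

lemma inscribed_has_dual:
  assumes "\<not> collinear {A, B, C}" "T \<in> inscribed_class A B C \<theta>1 \<theta>2 \<theta>3"
  obtains T' where "T' \<in> circumscribed_class A B C \<theta>1 \<theta>2 \<theta>3"
    "area T * area T' = (area (A, B, C))\<^sup>2"
proof -
  obtain X Y Z where T: "T = (X, Y, Z)" by (cases T)
  \<comment> \<open>The ratio forced by the value of the mixed form in the new position.\<close>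
  define k where "k = darea A B C / darea X Y Z"
  have XYZ: "darea X Y Z \<noteq> 0" "circumscribes (A, B, C) (X, Y, Z)" "has_angles X Y Z \<theta>1 \<theta>2 \<theta>3"
    using assms(2) by (simp_all add: T inscribed_class_iff[OF assms(1)] collinear_iff_darea)
  have "k \<noteq> 0"
    using assms(1) XYZ(1) by (simp add: k_def collinear_iff_darea)
  have "mixed (A, B, C) (X, Y, Z) = k * darea X Y Z"
    using mixed_if_circumscribes[OF XYZ(2)] XYZ(1) by (simp add: k_def mixed_commute[of A])
  with XYZ(1) obtain v where v: "circumscribes
      (homothetic v k X, homothetic v k Y, homothetic v k Z) (A, B, C)"
    using \<open>k \<noteq> 0\<close> by (rule homothetic_copy_circumscribed)
  show ?thesis
  proof
    show "(homothetic v k X, homothetic v k Y, homothetic v k Z)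
        \<in> circumscribed_class A B C \<theta>1 \<theta>2 \<theta>3"
      using v XYZ \<open>k \<noteq> 0\<close> by (simp add: circumscribed_class_iff collinear_iff_darea
          darea_homothetic has_angles_homothetic)
    show "area T * area (homothetic v k X, homothetic v k Y, homothetic v k Z)
        = (area (A, B, C))\<^sup>2"
      unfolding T area_eq_darea darea_homothetic k_def
      using XYZ(1) by (rule half_abs_mult_half_abs)
  qed
qed

lemma circumscribed_has_dual:
  assumes "\<not> collinear {A, B, C}" "T \<in> circumscribed_class A B C \<theta>1 \<theta>2 \<theta>3"
  obtains T' where "T' \<in> inscribed_class A B C \<theta>1 \<theta>2 \<theta>3"
    "area T * area T' = (area (A, B, C))\<^sup>2"
proof -
  obtain X Y Z where T: "T = (X, Y, Z)" by (cases T)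
  define k where "k = darea A B C / darea X Y Z"
  have XYZ: "darea X Y Z \<noteq> 0" "circumscribes (X, Y, Z) (A, B, C)" "has_angles X Y Z \<theta>1 \<theta>2 \<theta>3"
    using assms(2) by (simp_all add: T circumscribed_class_iff collinear_iff_darea)
  have ABC: "darea A B C \<noteq> 0"
    using assms(1) by (simp add: collinear_iff_darea)
  then have "k \<noteq> 0"
    using XYZ(1) by (simp add: k_def)
  have "k * mixed (A, B, C) (X, Y, Z) = darea A B C"
    using mixed_if_circumscribes[OF XYZ(2)] XYZ(1) by (simp add: k_def)
  with ABC obtain v where v: "circumscribes (A, B, C)
      (homothetic v k X, homothetic v k Y, homothetic v k Z)"
    by (rule homothetic_copy_inscribed)
  show ?thesis
  proof
    show "(homothetic v k X, homothetic v k Y, homothetic v k Z)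
        \<in> inscribed_class A B C \<theta>1 \<theta>2 \<theta>3"
      using v XYZ \<open>k \<noteq> 0\<close> by (simp add: inscribed_class_iff[OF assms(1)] collinear_iff_darea
          darea_homothetic has_angles_homothetic)
    show "area T * area (homothetic v k X, homothetic v k Y, homothetic v k Z)
        = (area (A, B, C))\<^sup>2"
      unfolding T area_eq_darea darea_homothetic k_def
      using XYZ(1) by (rule half_abs_mult_half_abs)
  qed
qed

section \<open>Reduction to the circumscribed maximum\<close>

text \<open>A pairing with constant area product carries the largest element of \<open>C\<close> to a smallest element of
  \<open>I\<close>; any two extremal triangles have the same areas as these two.\<close>

lemma extremal_area_duality_if_dual:
  assumes "area T0 > 0"
    and I_pos: "\<And>T. T \<in> I \<Longrightarrow> area T > 0" and C_pos: "\<And>T. T \<in> C \<Longrightarrow> area T > 0"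
    and I_dual: "\<And>T. T \<in> I \<Longrightarrow> \<exists>T'\<in>C. area T * area T' = (area T0)\<^sup>2"
    and C_dual: "\<And>T. T \<in> C \<Longrightarrow> \<exists>T'\<in>I. area T * area T' = (area T0)\<^sup>2"
    and "largest_area_in M C"
  shows "extremal_area_duality T0 I C"
proof -
  have M: "M \<in> C" "\<And>T. T \<in> C \<Longrightarrow> area T \<le> area M"
    using assms(6) by (simp_all add: largest_area_in_def)
  obtain N where N: "N \<in> I" "area M * area N = (area T0)\<^sup>2"
    using C_dual[OF M(1)] by blast
  have N_min: "area N \<le> area T" if T: "T \<in> I" for T
  proof -
    obtain T' where T': "T' \<in> C" "area T * area T' = area M * area N"
      using I_dual[OF T] N(2) by auto
    have "area M * area N = area T * area T'"
      using T'(2) by simp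
    also have "\<dots> \<le> area T * area M"
      using M(2)[OF T'(1)] I_pos[OF T] by (intro mult_left_mono) auto
    finally have "area M * area N \<le> area M * area T"
      by (simp only: mult.commute)
    then show ?thesis using C_pos[OF M(1)] by simp
  qed
  have "area T1 * area T2 = (area T0)\<^sup>2"
    if "smallest_area_in T1 I" "largest_area_in T2 C" for T1 T2
  proof -
    have "area T1 = area N"
      using that(1) N(1) N_min by (meson antisym smallest_area_in_def)
    moreover have "area T2 = area M"
      using that(2) M by (meson antisym largest_area_in_def)
    ultimately show ?thesis
      using N(2) by (simp add: mult.commute)
  qed
  moreover have "smallest_area_in N I"
    using N(1) N_min by (simp add: smallest_area_in_def)
  ultimately show ?thesis
    using assms(6) unfolding extremal_area_duality_def by blast
qed

lemma largest_area_in_Un: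
  assumes "largest_area_in M S1" "largest_area_in N S2"
  shows "largest_area_in M (S1 \<union> S2) \<or> largest_area_in N (S1 \<union> S2)"
  using assms linear[of "area M" "area N"]
    order_trans[of _ "area M" "area N"] order_trans[of _ "area N" "area M"]
  unfolding largest_area_in_def by blast

lemma ex_largest_area_in_UN:
  assumes "finite J" "J \<noteq> {}" "\<And>j. j \<in> J \<Longrightarrow> \<exists>T. largest_area_in T (S j)"
  shows "\<exists>T. largest_area_in T (\<Union>j\<in>J. S j)"
  using assms
proof (induction J rule: finite_ne_induct)
  case (insert i J)
  then show ?case
    unfolding UN_insert using largest_area_in_Un by blast
qed simp

section \<open>Triangles with given angles\<close>

lemma angle_at_eq:
  assumes "X \<noteq> Y" "X \<noteq> Z" "angle_at X Y Z = \<theta>"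
  shows "(Y - X) \<bullet> (Z - X) = norm (Y - X) * norm (Z - X) * cos \<theta>"
    and "\<bar>cross2 (Y - X) (Z - X)\<bar> = norm (Y - X) * norm (Z - X) * sin \<theta>"
proof -
  let ?m = "norm (Y - X) * norm (Z - X)"
  have m: "?m > 0" using assms(1,2) by simp
  have "\<bar>(Y - X) \<bullet> (Z - X)\<bar> \<le> ?m" by (rule Cauchy_Schwarz_ineq2)
  then have le: "\<bar>(Y - X) \<bullet> (Z - X) / ?m\<bar> \<le> 1"
    using m by (simp add: abs_mult)
  then have "cos \<theta> = (Y - X) \<bullet> (Z - X) / ?m"
    unfolding assms(3)[symmetric] angle_at_def by (rule cos_arccos_abs)
  then show dot: "(Y - X) \<bullet> (Z - X) = ?m * cos \<theta>"
    using m by (simp add: field_simps)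
  have "- 1 \<le> (Y - X) \<bullet> (Z - X) / ?m" "(Y - X) \<bullet> (Z - X) / ?m \<le> 1"
    using le by linarith+
  then have "0 \<le> sin \<theta>"
    unfolding assms(3)[symmetric] angle_at_def
    by (intro sin_ge_zero arccos_lbound arccos_ubound)
  then have nonneg: "0 \<le> ?m * sin \<theta>"
    using m by simp
  have "(cross2 (Y - X) (Z - X))\<^sup>2 = (?m * sin \<theta>)\<^sup>2"
    using lagrange_identity_2[of "Y - X" "Z - X"] unfolding dot
    by (simp add: power_mult_distrib sin_squared_eq right_diff_distrib)
  then have "\<bar>cross2 (Y - X) (Z - X)\<bar>\<^sup>2 = (?m * sin \<theta>)\<^sup>2"
    by simp
  then show "\<bar>cross2 (Y - X) (Z - X)\<bar> = ?m * sin \<theta>"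
    using abs_ge_zero nonneg by (rule power2_eq_imp_eq)
qed

text \<open>The dot and cross products determine the angle, with \<open>r\<close> playing the role of the product of the two
  side lengths; the latter equals \<open>r\<close> by Lagrange's identity.\<close>

lemma angle_at_eqI:
  assumes "(Y - X) \<bullet> (Z - X) = r * cos \<theta>" "\<bar>cross2 (Y - X) (Z - X)\<bar> = r * sin \<theta>"
    and "r > 0" "0 \<le> \<theta>" "\<theta> \<le> pi"
  shows "angle_at X Y Z = \<theta>"
proof -
  have "(norm (Y - X) * norm (Z - X))\<^sup>2
      = \<bar>cross2 (Y - X) (Z - X)\<bar>\<^sup>2 + ((Y - X) \<bullet> (Z - X))\<^sup>2"
    by (simp add: lagrange_identity_2 power_mult_distrib)
  also have "\<dots> = r\<^sup>2 * ((sin \<theta>)\<^sup>2 + (cos \<theta>)\<^sup>2)"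
    unfolding assms(1,2) by (simp only: power_mult_distrib distrib_left)
  finally have "(norm (Y - X) * norm (Z - X))\<^sup>2 = r\<^sup>2"
    by simp
  then have "norm (Y - X) * norm (Z - X) = r"
    by (rule power2_eq_imp_eq) (use assms(3) in auto)
  then show ?thesis
    unfolding angle_at_def assms(1) using assms(3-5) by (simp add: arccos_cos)
qed

text \<open>The triples of angles of non-degenerate triangles.\<close>

definition angle_triple :: "real \<Rightarrow> real \<Rightarrow> real \<Rightarrow> bool" where
  "angle_triple \<alpha> \<beta> \<gamma> \<longleftrightarrow> \<alpha> \<in> {0<..<pi} \<and> \<beta> \<in> {0<..<pi} \<and> \<gamma> \<in> {0<..<pi} \<and> \<alpha> + \<beta> + \<gamma> = pi"

text \<open>The position of the third vertex of a triangle with angles \<open>\<alpha>\<close>, \<open>\<beta>\<close>, \<open>\<gamma>\<close> whose first two vertices are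
  \<open>(0, 0)\<close> and \<open>(1, 0)\<close> is \<open>(apex_p, \<plusminus> apex_q)\<close>: by the law of sines its distance from the origin is
  \<open>sin \<beta> / sin \<gamma>\<close>.\<close>

definition apex_p :: "real \<Rightarrow> real \<Rightarrow> real \<Rightarrow> real" where
  "apex_p \<alpha> \<beta> \<gamma> = sin \<beta> * cos \<alpha> / sin \<gamma>"

definition apex_q :: "real \<Rightarrow> real \<Rightarrow> real \<Rightarrow> real" where
  "apex_q \<alpha> \<beta> \<gamma> = sin \<beta> * sin \<alpha> / sin \<gamma>"

lemma sin_pos_if_angle_triple:
  assumes "angle_triple \<alpha> \<beta> \<gamma>"
  shows "sin \<alpha> > 0" "sin \<beta> > 0" "sin \<gamma> > 0"
  using assms unfolding angle_triple_def by (auto intro: sin_gt_zero)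

lemma apex_q_pos:
  assumes "angle_triple \<alpha> \<beta> \<gamma>"
  shows "apex_q \<alpha> \<beta> \<gamma> > 0"
  using sin_pos_if_angle_triple[OF assms] by (simp add: apex_q_def)

lemma apex_if_has_angles:
  assumes angles: "angle_triple \<alpha> \<beta> \<gamma>"
    and "\<not> collinear {X, Y, Z}" "has_angles X Y Z \<alpha> \<beta> \<gamma>"
  obtains \<sigma> :: real where "\<sigma> \<in> {1, -1}"
    "Z - X = apex_p \<alpha> \<beta> \<gamma> *\<^sub>R (Y - X) + (\<sigma> * apex_q \<alpha> \<beta> \<gamma>) *\<^sub>R turn (Y - X)"
proof -
  let ?p = "apex_p \<alpha> \<beta> \<gamma>" and ?q = "apex_q \<alpha> \<beta> \<gamma>"
  note sin_pos = sin_pos_if_angle_triple[OF angles]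
  note dist = distinct_if_not_collinear[OF assms(2)]
  define a b c where abc: "a = norm (Z - Y)" "b = norm (Z - X)" "c = norm (Y - X)"
  have pos: "a > 0" "b > 0" "c > 0" using dist by (auto simp: abc)
  have dot: "(Y - X) \<bullet> (Z - X) = c * b * cos \<alpha>"
    and crA: "\<bar>cross2 (Y - X) (Z - X)\<bar> = c * b * sin \<alpha>"
    using angle_at_eq[of X Y Z \<alpha>] dist assms(3) by (auto simp: has_angles_def abc)
  have crB: "\<bar>cross2 (Y - X) (Z - X)\<bar> = a * c * sin \<beta>"
    using angle_at_eq(2)[of Y Z X \<beta>] dist assms(3)
    by (auto simp: has_angles_def abc norm_minus_commute cross2_def algebra_simps)
  have crC: "\<bar>cross2 (Y - X) (Z - X)\<bar> = b * a * sin \<gamma>"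
    using angle_at_eq(2)[of Z X Y \<gamma>] dist assms(3)
    by (auto simp: has_angles_def abc norm_minus_commute cross2_def algebra_simps)
  \<comment> \<open>The law of sines, from two expressions for the double area.\<close>
  have "a * (c * sin \<beta>) = a * (b * sin \<gamma>)"
    using crB crC by (simp only: mult.assoc mult.left_commute[of a b])
  then have b: "b = c * sin \<beta> / sin \<gamma>"
    using pos sin_pos by (simp add: field_simps)
  have "\<bar>cross2 (Y - X) (Z - X)\<bar> = c\<^sup>2 * ?q"
    unfolding crA b apex_q_def by (simp add: power2_eq_square)
  then have "cross2 (Y - X) (Z - X) = c\<^sup>2 * (1 * ?q) \<or>
      cross2 (Y - X) (Z - X) = c\<^sup>2 * (- 1 * ?q)"
    by (auto simp: abs_if split: if_splits)
  then obtain \<sigma> :: real where \<sigma>: "\<sigma> \<in> {1, -1}" "cross2 (Y - X) (Z - X) = c\<^sup>2 * (\<sigma> * ?q)"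
    by blast
  have "(Y - X) \<bullet> (Z - X) = c\<^sup>2 * ?p"
    unfolding dot b apex_p_def by (simp add: power2_eq_square)
  then have "c\<^sup>2 *\<^sub>R (Z - X)
      = c\<^sup>2 *\<^sub>R (?p *\<^sub>R (Y - X) + (\<sigma> * ?q) *\<^sub>R turn (Y - X))"
    using decompose_along[of "Y - X" "Z - X"] \<sigma>(2) by (simp add: abc scaleR_right_distrib)
  then have "Z - X = ?p *\<^sub>R (Y - X) + (\<sigma> * ?q) *\<^sub>R turn (Y - X)"
    using pos by (simp only: real_vector.scale_cancel_left) auto
  with \<sigma>(1) show ?thesis by (rule that)
qed

lemma has_angles_if_apex:
  fixes \<sigma> :: real
  assumes angles: "angle_triple \<alpha> \<beta> \<gamma>"
    and "u \<noteq> 0" "\<sigma> \<in> {1, -1}"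
  shows "has_angles X (X + u)
    (X + (apex_p \<alpha> \<beta> \<gamma> *\<^sub>R u + (\<sigma> * apex_q \<alpha> \<beta> \<gamma>) *\<^sub>R turn u)) \<alpha> \<beta> \<gamma>"
proof -
  let ?p = "apex_p \<alpha> \<beta> \<gamma>" and ?q = "apex_q \<alpha> \<beta> \<gamma>"
  note sin_pos = sin_pos_if_angle_triple[OF angles]
  note q_pos = apex_q_pos[OF angles]
  let ?Y = "X + u" and ?Z = "X + (?p *\<^sub>R u + (\<sigma> * ?q) *\<^sub>R turn u)"
  define n where "n = (norm u)\<^sup>2"
  have n: "n > 0" using assms(2) by (simp add: n_def)
  have n_eq: "n = (u$1)\<^sup>2 + (u$2)\<^sup>2" by (simp add: n_def norm_square_coords)
  have \<sigma>: "\<sigma>\<^sup>2 = 1" "\<bar>\<sigma>\<bar> = 1" using assms(3) by auto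
  have range: "0 < \<alpha>" "\<alpha> < pi" "0 < \<beta>" "\<beta> < pi" "0 < \<gamma>" "\<gamma> < pi"
    and sum: "\<alpha> + \<beta> + \<gamma> = pi"
    using angles by (auto simp: angle_triple_def)
  have \<gamma>: "\<gamma> = pi - (\<alpha> + \<beta>)" using sum by simp
  have \<beta>: "\<beta> = pi - (\<alpha> + \<gamma>)" using sum by simp
  have sg: "sin \<gamma> = sin \<alpha> * cos \<beta> + cos \<alpha> * sin \<beta>"
    unfolding \<gamma> by (simp add: sin_add)
  have sb: "sin \<beta> = sin \<alpha> * cos \<gamma> + cos \<alpha> * sin \<gamma>"
    unfolding \<beta> by (simp add: sin_add)
  \<comment> \<open>The dot products at the second and third vertex, for \<open>|u| = 1\<close>.\<close>
  have p1: "1 - ?p = sin \<alpha> / sin \<gamma> * cos \<beta>"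
    using sin_pos(3) sg by (simp add: apex_p_def field_simps)
  have "?p\<^sup>2 + ?q\<^sup>2 = (sin \<beta> / sin \<gamma>)\<^sup>2 * ((cos \<alpha>)\<^sup>2 + (sin \<alpha>)\<^sup>2)"
    by (simp only: apex_p_def apex_q_def power_mult_distrib power_divide distrib_left) simp
  then have "?p\<^sup>2 - ?p + ?q\<^sup>2 = sin \<beta> * (sin \<beta> - cos \<alpha> * sin \<gamma>) / (sin \<gamma>)\<^sup>2"
    using sin_pos(3) by (simp add: apex_p_def power_divide field_simps power2_eq_square)
  then have p2: "?p\<^sup>2 - ?p + ?q\<^sup>2 = sin \<beta> * sin \<alpha> / (sin \<gamma>)\<^sup>2 * cos \<gamma>"
    using sb by simp
  have dots: "(?Y - X) \<bullet> (?Z - X) = n * ?p"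
    "(?Z - ?Y) \<bullet> (X - ?Y) = n * (1 - ?p)"
    "(X - ?Z) \<bullet> (?Y - ?Z) = n * (?p\<^sup>2 - ?p + \<sigma>\<^sup>2 * ?q\<^sup>2)"
    unfolding n_eq by (simp_all add: inner_coords algebra_simps power2_eq_square)
  have "cross2 (?Y - X) (?Z - X) = \<sigma> * (n * ?q)"
    "cross2 (?Z - ?Y) (X - ?Y) = \<sigma> * (n * ?q)"
    "cross2 (X - ?Z) (?Y - ?Z) = \<sigma> * (n * ?q)"
    unfolding n_eq by (simp_all add: cross2_def algebra_simps power2_eq_square)
  then have crs: "\<bar>cross2 (?Y - X) (?Z - X)\<bar> = n * ?q"
    "\<bar>cross2 (?Z - ?Y) (X - ?Y)\<bar> = n * ?q"
    "\<bar>cross2 (X - ?Z) (?Y - ?Z)\<bar> = n * ?q"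
    using n q_pos \<sigma> by (simp_all add: abs_mult)
  have "angle_at X ?Y ?Z = \<alpha>"
  proof (rule angle_at_eqI)
    show "(?Y - X) \<bullet> (?Z - X) = n * (sin \<beta> / sin \<gamma>) * cos \<alpha>"
      unfolding dots unfolding apex_p_def by simp
    show "\<bar>cross2 (?Y - X) (?Z - X)\<bar> = n * (sin \<beta> / sin \<gamma>) * sin \<alpha>"
      unfolding crs unfolding apex_q_def by simp
  qed (use n sin_pos range in auto)
  moreover have "angle_at ?Y ?Z X = \<beta>"
  proof (rule angle_at_eqI)
    show "(?Z - ?Y) \<bullet> (X - ?Y) = n * (sin \<alpha> / sin \<gamma>) * cos \<beta>"
      unfolding dots p1 by simp
    show "\<bar>cross2 (?Z - ?Y) (X - ?Y)\<bar> = n * (sin \<alpha> / sin \<gamma>) * sin \<beta>"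
      unfolding crs unfolding apex_q_def by simp
  qed (use n sin_pos range in auto)
  moreover have "angle_at ?Z X ?Y = \<gamma>"
  proof (rule angle_at_eqI)
    show "(X - ?Z) \<bullet> (?Y - ?Z) = n * (sin \<beta> * sin \<alpha> / (sin \<gamma>)\<^sup>2) * cos \<gamma>"
      unfolding dots \<sigma>(1) using p2 by simp
    show "\<bar>cross2 (X - ?Z) (?Y - ?Z)\<bar> = n * (sin \<beta> * sin \<alpha> / (sin \<gamma>)\<^sup>2) * sin \<gamma>"
      unfolding crs unfolding apex_q_def using sin_pos(3) by (simp add: power2_eq_square)
  qed (use n sin_pos range in auto)
  ultimately show ?thesis by (simp add: has_angles_def)
qed

section \<open>The largest circumscribed triangle\<close>

text \<open>The bound by the Cauchy-Schwarz inequality is attained where the vector \<open>u\<close> is parallel to \<open>g \<tau>\<close>.\<close>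

lemma ex_largest_circumscribed:
  assumes angles: "angle_triple \<alpha> \<beta> \<gamma>"
    and "\<not> collinear {A, B, C}"
  shows "\<exists>T. largest_area_in T (circumscribed_class A B C \<alpha> \<beta> \<gamma>)"
proof -
  let ?p = "apex_p \<alpha> \<beta> \<gamma>" and ?q = "apex_q \<alpha> \<beta> \<gamma>"
  note q_pos = apex_q_pos[OF angles]
  define w where "w = (\<lambda>(\<sigma>::real) u. ?p *\<^sub>R u + (\<sigma> * ?q) *\<^sub>R turn u)"
  define g where "g = (\<lambda>\<sigma>::real. turn ((?p - 1) *\<^sub>R A - ?p *\<^sub>R B + C) + (\<sigma> * ?q) *\<^sub>R (A - B))"
  have mixed_g: "mixed (A, B, C) (X, X + u, X + w \<sigma> u) = g \<sigma> \<bullet> u" for X u \<sigma>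
    by (simp add: mixed_def g_def w_def cross2_def inner_coords algebra_simps)
  have darea_w: "darea X (X + u) (X + w \<sigma> u) = \<sigma> * ?q * (norm u)\<^sup>2" for X u \<sigma>
    unfolding norm_square_coords
    by (simp add: darea_def w_def cross2_def power2_eq_square algebra_simps)
  \<comment> \<open>The better orientation; ties are broken arbitrarily.\<close>
  define \<tau> :: real where "\<tau> = (if norm (g (-1)) \<le> norm (g 1) then 1 else -1)"
  have \<tau>: "\<tau> \<in> {1, -1}" by (simp add: \<tau>_def)
  have g_le: "norm (g \<sigma>) \<le> norm (g \<tau>)" if "\<sigma> \<in> {1, -1}" for \<sigma>
    using that by (auto simp: \<tau>_def)
  have "g 1 - g (-1) = (2 * ?q) *\<^sub>R (A - B)"
    by (simp add: g_def scaleR_2 flip: scaleR_scaleR)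
  also have "\<dots> \<noteq> 0"
    using q_pos distinct_if_not_collinear(1)[OF assms(2)] by simp
  finally have "g \<tau> \<noteq> 0"
    using g_le[of 1] g_le[of "-1"] by auto
  \<comment> \<open>Scaled so that the mixed form already equals the double signed area, which makes the ratio 1.\<close>
  define u where "u = (\<tau> / ?q) *\<^sub>R g \<tau>"
  have u: "u \<noteq> 0" "norm u = norm (g \<tau>) / ?q"
    using \<open>g \<tau> \<noteq> 0\<close> \<tau> q_pos by (auto simp: u_def)
  have nz: "darea 0 (0 + u) (0 + w \<tau> u) \<noteq> 0"
    using u(1) \<tau> q_pos by (auto simp: darea_w simp del: add_0)
  have "mixed (A, B, C) (0, 0 + u, 0 + w \<tau> u) = 1 * darea 0 (0 + u) (0 + w \<tau> u)"
    unfolding mixed_g darea_w u(2) using q_pos \<tau>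
    by (auto simp: u_def dot_square_norm power_divide field_simps power2_eq_square)
  with nz obtain v where v: "circumscribes
      (homothetic v 1 0, homothetic v 1 (0 + u), homothetic v 1 (0 + w \<tau> u)) (A, B, C)"
    by (rule homothetic_copy_circumscribed) simp
  define T where "T = (v, v + u, v + w \<tau> u)"
  have angles_T: "has_angles v (v + u) (v + w \<tau> u) \<alpha> \<beta> \<gamma>"
    unfolding w_def by (rule has_angles_if_apex[OF angles u(1) \<tau>])
  have nz_T: "darea v (v + u) (v + w \<tau> u) \<noteq> 0"
    using nz unfolding darea_w .
  have "T \<in> circumscribed_class A B C \<alpha> \<beta> \<gamma>"
    using v angles_T nz_T
    by (simp add: T_def circumscribed_class_iff collinear_iff_darea homothetic_def)
  moreover have "area T' \<le> area T" if T'_in: "T' \<in> circumscribed_class A B C \<alpha> \<beta> \<gamma>" for T'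
  proof -
    obtain X Y Z where T': "T' = (X, Y, Z)" by (cases T')
    have XYZ: "\<not> collinear {X, Y, Z}" "circumscribes (X, Y, Z) (A, B, C)"
      "has_angles X Y Z \<alpha> \<beta> \<gamma>"
      using T'_in by (simp_all add: T' circumscribed_class_iff)
    obtain \<sigma> :: real where \<sigma>: "\<sigma> \<in> {1, -1}" "Z - X = w \<sigma> (Y - X)"
      using apex_if_has_angles[OF angles XYZ(1,3)] unfolding w_def by blast
    define d where "d = Y - X"
    have YZ: "Y = X + d" "Z = X + w \<sigma> d"
      using \<sigma>(2) by (simp_all add: d_def algebra_simps)
    have "d \<noteq> 0" using distinct_if_not_collinear(1)[OF XYZ(1)] by (simp add: d_def)
    have "g \<sigma> \<bullet> d = \<sigma> * ?q * (norm d)\<^sup>2"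
      using mixed_if_circumscribes[OF XYZ(2)] unfolding YZ mixed_g darea_w .
    then have "?q * (norm d)\<^sup>2 = \<bar>g \<sigma> \<bullet> d\<bar>"
      using \<sigma>(1) q_pos by auto
    also have "\<dots> \<le> norm (g \<sigma>) * norm d"
      by (rule Cauchy_Schwarz_ineq2)
    also have "\<dots> \<le> norm (g \<tau>) * norm d"
      using g_le[OF \<sigma>(1)] by (rule mult_right_mono) simp
    finally have "?q * norm d \<le> norm (g \<tau>)"
      using \<open>d \<noteq> 0\<close> by (simp add: power2_eq_square)
    then have "norm d \<le> norm u"
      using q_pos by (simp add: u(2) field_simps)
    then have "(norm d)\<^sup>2 \<le> (norm u)\<^sup>2"
      by (rule power_mono) simp
    then show ?thesis
      using \<sigma>(1) \<tau> q_pos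
      by (auto simp: T' T_def area_eq_darea YZ darea_w abs_mult)
  qed
  ultimately have "largest_area_in T (circumscribed_class A B C \<alpha> \<beta> \<gamma>)"
    by (simp add: largest_area_in_def)
  then show ?thesis ..
qed

section \<open>Extremal triangles\<close>

text \<open>A single class and the union over all permutations are both instances, with \<open>J\<close> a singleton and \<open>J\<close>
  the set of permutations.\<close>

lemma extremal_area_duality_UN:
  assumes ABC: "\<not> collinear {A, B, C}" and J: "finite J" "J \<noteq> {}"
    and angles: "\<And>\<theta>1 \<theta>2 \<theta>3. (\<theta>1, \<theta>2, \<theta>3) \<in> J \<Longrightarrow> angle_triple \<theta>1 \<theta>2 \<theta>3"
  shows "extremal_area_duality (A, B, C)
    (\<Union>(\<theta>1, \<theta>2, \<theta>3)\<in>J. inscribed_class A B C \<theta>1 \<theta>2 \<theta>3)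
    (\<Union>(\<theta>1, \<theta>2, \<theta>3)\<in>J. circumscribed_class A B C \<theta>1 \<theta>2 \<theta>3)" (is "extremal_area_duality _ ?I ?C")
proof -
  have "\<exists>T. largest_area_in T (case j of (\<theta>1, \<theta>2, \<theta>3) \<Rightarrow> circumscribed_class A B C \<theta>1 \<theta>2 \<theta>3)"
    if "j \<in> J" for j
    using that angles ex_largest_circumscribed[OF _ ABC] by (cases j) auto
  with J have "\<exists>T. largest_area_in T ?C"
    by (rule ex_largest_area_in_UN)
  then obtain M where M: "largest_area_in M ?C" ..
  show ?thesis
  proof (rule extremal_area_duality_if_dual[OF _ _ _ _ _ M])
    show "area (A, B, C) > 0"
      using ABC by (simp only: area_pos_iff) simp
    show "area T > 0" if "T \<in> ?I" for T
      using that by (auto simp: inscribed_class_def area_pos_iff)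
    show "area T > 0" if "T \<in> ?C" for T
      using that by (auto simp: circumscribed_class_def area_pos_iff)
    show "\<exists>T'\<in>?C. area T * area T' = (area (A, B, C))\<^sup>2" if T_in: "T \<in> ?I" for T
    proof -
      obtain \<theta>1 \<theta>2 \<theta>3 where \<theta>: "(\<theta>1, \<theta>2, \<theta>3) \<in> J" "T \<in> inscribed_class A B C \<theta>1 \<theta>2 \<theta>3"
        using T_in by auto
      show ?thesis
        by (rule inscribed_has_dual[OF ABC \<theta>(2)]) (use \<theta>(1) in blast)
    qed
    show "\<exists>T'\<in>?I. area T * area T' = (area (A, B, C))\<^sup>2" if T_in: "T \<in> ?C" for T
    proof -
      obtain \<theta>1 \<theta>2 \<theta>3 where \<theta>: "(\<theta>1, \<theta>2, \<theta>3) \<in> J" "T \<in> circumscribed_class A B C \<theta>1 \<theta>2 \<theta>3"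
        using T_in by auto
      show ?thesis
        by (rule circumscribed_has_dual[OF ABC \<theta>(2)]) (use \<theta>(1) in blast)
    qed
  qed
qed

lemma angle_permsD:
  assumes "(\<theta>1, \<theta>2, \<theta>3) \<in> angle_perms \<alpha> \<beta> \<gamma>"
  shows "{\<theta>1, \<theta>2, \<theta>3} = {\<alpha>, \<beta>, \<gamma>}" "\<theta>1 + \<theta>2 + \<theta>3 = \<alpha> + \<beta> + \<gamma>"
proof -
  have eq: "mset [\<theta>1, \<theta>2, \<theta>3] = mset [\<alpha>, \<beta>, \<gamma>]"
    using assms by (simp add: angle_perms_def)
  have "set_mset (mset [\<theta>1, \<theta>2, \<theta>3]) = set_mset (mset [\<alpha>, \<beta>, \<gamma>])"
    by (simp only: eq)
  then show "{\<theta>1, \<theta>2, \<theta>3} = {\<alpha>, \<beta>, \<gamma>}" by simp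
  have "sum_mset (mset [\<theta>1, \<theta>2, \<theta>3]) = sum_mset (mset [\<alpha>, \<beta>, \<gamma>])"
    by (simp only: eq)
  then show "\<theta>1 + \<theta>2 + \<theta>3 = \<alpha> + \<beta> + \<gamma>" by (simp add: add.assoc)
qed

lemma finite_angle_perms: "finite (angle_perms \<alpha> \<beta> \<gamma>)"
proof (rule finite_subset)
  show "angle_perms \<alpha> \<beta> \<gamma> \<subseteq> {\<alpha>, \<beta>, \<gamma>} \<times> {\<alpha>, \<beta>, \<gamma>} \<times> {\<alpha>, \<beta>, \<gamma>}"
  proof
    fix j assume "j \<in> angle_perms \<alpha> \<beta> \<gamma>"
    moreover obtain \<theta>1 \<theta>2 \<theta>3 where j: "j = (\<theta>1, \<theta>2, \<theta>3)"
      by (cases j)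
    ultimately have "{\<theta>1, \<theta>2, \<theta>3} = {\<alpha>, \<beta>, \<gamma>}"
      using angle_permsD(1) by blast
    then show "j \<in> {\<alpha>, \<beta>, \<gamma>} \<times> {\<alpha>, \<beta>, \<gamma>} \<times> {\<alpha>, \<beta>, \<gamma>}"
      unfolding j by blast
  qed
qed simp

theorem theorem2p3:
  fixes A B C :: "real^2" and \<alpha> \<beta> \<gamma> :: real
  assumes "\<not> collinear {A, B, C}"
    and "\<alpha> \<in> {0<..<pi}" and "\<beta> \<in> {0<..<pi}" and "\<gamma> \<in> {0<..<pi}"
    and "\<alpha> + \<beta> + \<gamma> = pi"
  shows "extremal_area_duality (A, B, C)
           (inscribed_class A B C \<alpha> \<beta> \<gamma>) (circumscribed_class A B C \<alpha> \<beta> \<gamma>)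
       \<and> (\<forall>(\<theta>1, \<theta>2, \<theta>3) \<in> angle_perms \<alpha> \<beta> \<gamma>.
            extremal_area_duality (A, B, C)
              (inscribed_class A B C \<theta>1 \<theta>2 \<theta>3) (circumscribed_class A B C \<theta>1 \<theta>2 \<theta>3))
       \<and> extremal_area_duality (A, B, C)
           (inscribed_similar A B C \<alpha> \<beta> \<gamma>) (circumscribed_similar A B C \<alpha> \<beta> \<gamma>)"
proof -
  have angles: "angle_triple \<theta>1 \<theta>2 \<theta>3"
    if "(\<theta>1, \<theta>2, \<theta>3) \<in> angle_perms \<alpha> \<beta> \<gamma>" for \<theta>1 \<theta>2 \<theta>3
  proof -
    have "{\<theta>1, \<theta>2, \<theta>3} \<subseteq> {0<..<pi}"
      unfolding angle_permsD(1)[OF that] using assms by simp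
    then show ?thesis
      using angle_permsD(2)[OF that] assms(5) by (simp add: angle_triple_def)
  qed
  have mem: "(\<alpha>, \<beta>, \<gamma>) \<in> angle_perms \<alpha> \<beta> \<gamma>"
    by (simp add: angle_perms_def)
  have single: "extremal_area_duality (A, B, C)
      (inscribed_class A B C \<theta>1 \<theta>2 \<theta>3) (circumscribed_class A B C \<theta>1 \<theta>2 \<theta>3)"
    if "(\<theta>1, \<theta>2, \<theta>3) \<in> angle_perms \<alpha> \<beta> \<gamma>" for \<theta>1 \<theta>2 \<theta>3
    using extremal_area_duality_UN[OF assms(1), of "{(\<theta>1, \<theta>2, \<theta>3)}"] angles[OF that] by simp
  have "extremal_area_duality (A, B, C)
      (inscribed_similar A B C \<alpha> \<beta> \<gamma>) (circumscribed_similar A B C \<alpha> \<beta> \<gamma>)"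
    unfolding inscribed_similar_def circumscribed_similar_def
    using mem angles by (intro extremal_area_duality_UN[OF assms(1) finite_angle_perms]) auto
  with single mem show ?thesis by auto
qed

end
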